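(* With the vectors $|e_n\rangle,|e_n^*\rangle,|f_n\rangle,|f_n^*\rangle$ of $\mathcal V_N$ defined in the context, set $S_m(n):=\langle e_m|f_n^*\rangle$ and $\tilde S_m(n):=\langle e_m^*|f_n\rangle$, and let $$\hat\alpha=q^{\mu-\beta-1},\qquad \hat\beta=q^{-\mu-\beta-1}.$$ Assume no denominator appearing below or in the context vanishes. Then for all $m,n=0,1,\dots,N$, $$S_m(n)=\frac{a_0a_1\cdots a_{n-1}}{a_0a_1\cdots a_{m-1}}\,q^{m(\alpha-\beta-N+m-1)+n(\beta-\alpha+\frac n2+\frac12)}\,\frac{(q;q)_N(-1)^n}{(q;q)_n(q;q)_{N-m}}\,\frac{(\hat\alpha q;q)_n}{(\hat\alpha\hat\beta q^{m+1};q)_m}\,Q_m(q^{-n};\hat\alpha,\hat\beta,N;q),$$ $$\tilde S_m(n)=\frac{a_na_{n+1}\cdots a_{N-1}}{a_ma_{m+1}\cdots a_{N-1}}\,\hat\alpha^{N-m-n}\,q^{m(\beta-\alpha+N-m)+n(\alpha-\beta-\frac n2-\frac32)+N}\,\frac{(q;q)_N(-1)^n(\hat\alpha q;q)_m}{(q;q)_m(q;q)_{N-n}(\hat\beta q;q)_m}\,\frac{(\hat\beta q;q)_{N-n}}{(\hat\alpha\hat\beta q^{2m+2};q)_{N-m}}\,Q_m(q^{-n};\hat\alpha,\hat\beta,N;q),$$ where $Q_m$ denotes the $q$-Hahn polynomials.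
   Context: $q$ is real, $q>0$, $q\ne1$; $[x]_q=\frac{1-q^x}{1-q}$; $(a;q)_0=1$, $(a;q)_k=\prod_{i=0}^{k-1}(1-aq^i)$. $N$ is a positive integer, $\alpha,\beta,\mu$ are real parameters, $a_0,\dots,a_{N-1}$ are nonzero real constants. Empty products equal $1$. The $q$-Hahn polynomials are, for $m=0,\dots,N$, $$Q_m(q^{-x};\hat\alpha,\hat\beta,N;q)=\sum_{k=0}^{m}\frac{(q^{-m};q)_k(\hat\alpha\hat\beta q^{m+1};q)_k(q^{-x};q)_k}{(\hat\alpha q;q)_k(q^{-N};q)_k}\frac{q^k}{(q;q)_k}.$$ $\mathcal V_N$ is a real $(N+1)$-dimensional vector space with scalar product $\langle v|w\rangle$ and orthonormal basis $\{|n\rangle\}_{n=0}^N$. For $n=0,\dots,N$ define $$|e_n\rangle=\sum_{\ell=0}^N\frac{a_0\cdots a_{\ell-1}}{a_0\cdots a_{n-1}}\frac{q^{(\alpha-\beta-1)n}}{q^{(\alpha-\beta-1)\ell}}\frac{(q^{-n};q)_\ell}{(q^{-n};q)_n}\frac{(q;q)_n}{(q;q)_\ell}\frac{(q^{-N};q)_n}{(q^{-N};q)_\ell}\frac{(q^{n-2\beta-1};q)_\ell}{(q^{n-2\beta-1};q)_n}|\ell\rangle,$$ $$|e_n^*\rangle=\sum_{\ell=0}^N\frac{a_\ell\cdots a_{N-1}}{a_n\cdots a_{N-1}}\frac{q^{(\alpha+\beta-N)(N-n)}}{q^{(\alpha+\beta-N)(N-\ell)}}\frac{(q^{n-N};q)_{N-\ell}}{(q^{n-N};q)_{N-n}}\frac{(q;q)_{N-n}}{(q;q)_{N-\ell}}\frac{(q^{-N};q)_{N-n}}{(q^{-N};q)_{N-\ell}}\frac{(q^{-N-n+2\beta+1};q)_{N-\ell}}{(q^{-N-n+2\beta+1};q)_{N-n}}|\ell\rangle,$$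 $$|f_n\rangle=\sum_{\ell=0}^N\frac{a_n\cdots a_{N-1}}{a_\ell\cdots a_{N-1}}\frac{q^{(\alpha-\mu-n)(N-\ell)}}{q^{(\alpha-\mu-n)(N-n)}}\frac{(q^{n-N};q)_{N-\ell}}{(q^{n-N};q)_{N-n}}\frac{(q^{\beta-\mu-N+1};q)_{N-n}}{(q^{\beta-\mu-N+1};q)_{N-\ell}}|\ell\rangle,$$ $$|f_n^*\rangle=\sum_{\ell=0}^N\frac{a_0\cdots a_{n-1}}{a_0\cdots a_{\ell-1}}\frac{q^{(\beta-\alpha)n}}{q^{(\beta-\alpha)\ell}}\frac{(q^{-n};q)_\ell}{(q^{-n};q)_n}\frac{(q^{\mu-\beta};q)_n}{(q^{\mu-\beta};q)_\ell}|\ell\rangle.$$ With the operators $Z|n\rangle=-|n\rangle+a_n|n+1\rangle$, $X|n\rangle=-[\alpha-n]_q|n\rangle+a_n[\beta-n]_q|n+1\rangle$, $V|n\rangle=[n-\beta]_q[\beta-n+1]_q|n\rangle-\frac{q^{\alpha-N}[n]_q[N+1-n]_q}{a_{n-1}}|n-1\rangle$ (conventions $a_{-1}=a_N=0$, no out-of-range terms), these are the eigenvectors of $V$, $V^\top$, $W=X-[\mu]_qZ$ and $W^\top$ respectively, with eigenvalues $\nu_n=[n-\beta]_q[\beta-n+1]_q$ for $|e_n\rangle,|e_n^*\rangle$ and $\rho_n=-[\alpha-n]_q+[\mu]_q$ for $|f_n\rangle,|f_n^*\rangle$, normalized so that the coefficient of $|n\rangle$ is $1$. *)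

theory Defs
  imports "HOL-Analysis.Analysis"
begin

text \<open>
  Powers of \<open>q\<close> with real or negative exponents are written with \<open>powr\<close>; this is
  the usual power only for \<open>q > 0\<close>.
\<close>

definition qpoch :: "real \<Rightarrow> real \<Rightarrow> nat \<Rightarrow> real" where
  "qpoch x q k = (\<Prod>i<k. 1 - x * q ^ i)"

text \<open>The argument \<open>y\<close> stands for the variable \<open>q\<close> to the power \<open>-x\<close>, in which
  \<open>q_hahn m\<close> is a polynomial.\<close>

definition q_hahn :: "nat \<Rightarrow> real \<Rightarrow> real \<Rightarrow> real \<Rightarrow> nat \<Rightarrow> real \<Rightarrow> real" where
  "q_hahn m y A B N q =
    (\<Sum>k\<le>m. (qpoch (q powr - real m) q k * qpoch (A * B * q ^ (m + 1)) q k * qpoch y q k)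
            / (qpoch (A * q) q k * qpoch (q powr - real N) q k)
            * (q ^ k / qpoch q q k))"

definition orthonormal_basis :: "nat \<Rightarrow> (nat \<Rightarrow> 'v::real_inner) \<Rightarrow> bool" where
  "orthonormal_basis N ket \<longleftrightarrow>
     (\<forall>i\<le>N. \<forall>j\<le>N. ket i \<bullet> ket j = (if i = j then 1 else 0)) \<and> span (ket ` {..N}) = UNIV"

definition e_vec ::
  "(nat \<Rightarrow> 'v::real_inner) \<Rightarrow> (nat \<Rightarrow> real) \<Rightarrow> real \<Rightarrow> nat \<Rightarrow> real \<Rightarrow> real \<Rightarrow> nat \<Rightarrow> 'v" where
  "e_vec ket a q N \<alpha> \<beta> n =
    (\<Sum>l\<le>N.
      ((\<Prod>i<l. a i) / (\<Prod>i<n. a i)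
       * (q powr ((\<alpha> - \<beta> - 1) * real n) / q powr ((\<alpha> - \<beta> - 1) * real l))
       * (qpoch (q powr - real n) q l / qpoch (q powr - real n) q n)
       * (qpoch q q n / qpoch q q l)
       * (qpoch (q powr - real N) q n / qpoch (q powr - real N) q l)
       * (qpoch (q powr (real n - 2 * \<beta> - 1)) q l / qpoch (q powr (real n - 2 * \<beta> - 1)) q n))
      *\<^sub>R ket l)"

definition e_star_vec ::
  "(nat \<Rightarrow> 'v::real_inner) \<Rightarrow> (nat \<Rightarrow> real) \<Rightarrow> real \<Rightarrow> nat \<Rightarrow> real \<Rightarrow> real \<Rightarrow> nat \<Rightarrow> 'v" where
  "e_star_vec ket a q N \<alpha> \<beta> n =
    (\<Sum>l\<le>N.
      ((\<Prod>i\<in>{l..<N}. a i) / (\<Prod>i\<in>{n..<N}. a i)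
       * (q powr ((\<alpha> + \<beta> - real N) * real (N - n)) / q powr ((\<alpha> + \<beta> - real N) * real (N - l)))
       * (qpoch (q powr (real n - real N)) q (N - l) / qpoch (q powr (real n - real N)) q (N - n))
       * (qpoch q q (N - n) / qpoch q q (N - l))
       * (qpoch (q powr - real N) q (N - n) / qpoch (q powr - real N) q (N - l))
       * (qpoch (q powr (- real N - real n + 2 * \<beta> + 1)) q (N - l)
          / qpoch (q powr (- real N - real n + 2 * \<beta> + 1)) q (N - n)))
      *\<^sub>R ket l)"

definition f_vec ::
  "(nat \<Rightarrow> 'v::real_inner) \<Rightarrow> (nat \<Rightarrow> real) \<Rightarrow> real \<Rightarrow> nat \<Rightarrow> real \<Rightarrow> real \<Rightarrow> real \<Rightarrow> nat \<Rightarrow> 'v" where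
  "f_vec ket a q N \<alpha> \<beta> \<mu> n =
    (\<Sum>l\<le>N.
      ((\<Prod>i\<in>{n..<N}. a i) / (\<Prod>i\<in>{l..<N}. a i)
       * (q powr ((\<alpha> - \<mu> - real n) * real (N - l)) / q powr ((\<alpha> - \<mu> - real n) * real (N - n)))
       * (qpoch (q powr (real n - real N)) q (N - l) / qpoch (q powr (real n - real N)) q (N - n))
       * (qpoch (q powr (\<beta> - \<mu> - real N + 1)) q (N - n)
          / qpoch (q powr (\<beta> - \<mu> - real N + 1)) q (N - l)))
      *\<^sub>R ket l)"

definition f_star_vec ::
  "(nat \<Rightarrow> 'v::real_inner) \<Rightarrow> (nat \<Rightarrow> real) \<Rightarrow> real \<Rightarrow> nat \<Rightarrow> real \<Rightarrow> real \<Rightarrow> real \<Rightarrow> nat \<Rightarrow> 'v" where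
  "f_star_vec ket a q N \<alpha> \<beta> \<mu> n =
    (\<Sum>l\<le>N.
      ((\<Prod>i<n. a i) / (\<Prod>i<l. a i)
       * (q powr ((\<beta> - \<alpha>) * real n) / q powr ((\<beta> - \<alpha>) * real l))
       * (qpoch (q powr - real n) q l / qpoch (q powr - real n) q n)
       * (qpoch (q powr (\<mu> - \<beta>)) q n / qpoch (q powr (\<mu> - \<beta>)) q l))
      *\<^sub>R ket l)"

end

theory Submission
  imports Defs
begin

text \<open>
  In \<open>\<langle>e_m|f_n\<^sup>*\<rangle>\<close> the summands are, up to a common factor, literally those of the
  \<open>q\<close>-Hahn polynomial. After reversing the summation, \<open>\<langle>e_m\<^sup>*|f_n\<rangle>\<close> becomes a terminating
  \<open>\<^sub>3\<phi>\<^sub>2(a, b, c; d, e; q, de/abc)\<close> with \<open>d = q\<close> to the power \<open>-N\<close>, which has to be turned into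
  \<open>\<^sub>3\<phi>\<^sub>2(d/a, d/b, d/c; d, qd/e; q, q)\<close>. This is obtained by applying three times the classical
  transformation between terminating \<open>\<^sub>3\<phi>\<^sub>2\<close> series of these two types, which follows from the two
  \<open>q\<close>-Vandermonde sums by interchanging a double summation. The transformation is kept in a form
  that divides only by \<open>(d; q)\<^sub>k\<close>, because the denominators of the intermediate series
  may vanish under the given hypotheses.
\<close>

section \<open>q-shifted factorials\<close>

lemma qpoch_0 [simp]: "qpoch x q 0 = 1"
  by (simp add: qpoch_def)

lemma qpoch_Suc: "qpoch x q (Suc n) = qpoch x q n * (1 - x * q ^ n)"
  by (simp add: qpoch_def)

lemma qpoch_add: "qpoch x q (m + n) = qpoch x q m * qpoch (x * q ^ m) q n"
  by (induction n) (simp_all add: qpoch_Suc power_add mult.assoc)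

lemma qpoch_split: "k \<le> n \<Longrightarrow> qpoch x q n = qpoch x q k * qpoch (x * q ^ k) q (n - k)"
  using qpoch_add[of x q k "n - k"] by simp

lemma qpoch_Suc_left: "qpoch x q (Suc n) = (1 - x) * qpoch (x * q) q n"
  using qpoch_add[of x q 1 n] by (simp add: qpoch_Suc)

text \<open>The hypothesis makes \<open>x * q ^ i\<close> and \<open>y * q ^ (n - Suc i)\<close>
  reciprocal, and 1 - t = -t (1 - 1/t). The factors of the second symbol thus appear in reverse
  order.\<close>

lemma qpoch_reverse:
  assumes "x * y * q ^ n = q" "q \<noteq> 0"
  shows "qpoch x q n = (-1) ^ n * x ^ n * q ^ (n choose 2) * qpoch y q n"
proof -
  have *: "1 - x * q ^ i = (- x * q ^ i) * (1 - y * q ^ (n - Suc i))" if "i < n" for i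
  proof -
    have "q ^ n = q * (q ^ i * q ^ (n - Suc i))"
      using that by (simp flip: power_add power_Suc)
    with assms have "x * q ^ i * (y * q ^ (n - Suc i)) = 1"
      by (simp add: mult.assoc mult.left_commute)
    then show ?thesis
      by (simp add: algebra_simps)
  qed
  have "qpoch x q n = (\<Prod>i<n. - x * q ^ i) * (\<Prod>i<n. 1 - y * q ^ (n - Suc i))"
    unfolding qpoch_def prod.distrib[symmetric] using * by (intro prod.cong) auto
  moreover have "(\<Prod>i<n. - x * q ^ i) = (-1) ^ n * x ^ n * q ^ (n choose 2)" for n
    by (induction n) (simp_all add: numeral_2_eq_2 power_add mult_ac)
  moreover have "(\<Prod>i<n. 1 - y * q ^ (n - Suc i)) = qpoch y q n"
    unfolding qpoch_def by (rule prod.nat_diff_reindex)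
  ultimately show ?thesis
    by simp
qed

text \<open>The Gaussian binomial coefficient. The value 0 for \<open>k > n\<close> makes the Pascal
  rules hold at the edge and lets summation ranges be enlarged.\<close>

definition qbinom :: "real \<Rightarrow> nat \<Rightarrow> nat \<Rightarrow> real" where
  "qbinom q n k = (if k \<le> n then qpoch q q n / (qpoch q q k * qpoch q q (n - k)) else 0)"

text \<open>Exponents of q are compared as natural numbers, so this identity and the next are stated
  without subtraction.\<close>

lemma choose_two_add: "(k + i choose 2) = (k choose 2) + (i choose 2) + k * i"
  by (induction i) (simp_all add: numeral_2_eq_2)

lemma choose_two_double: "(k choose 2) + (k choose 2) + k = k * k"
  by (induction k) (simp_all add: numeral_2_eq_2)

text \<open>Links the homogeneous product, which allows \<open>q_Vandermonde_2\<close> to be stated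
  without dividing by \<open>x\<close>, to a q-shifted factorial.\<close>

lemma prod_diff_eq_qpoch: "x \<noteq> 0 \<Longrightarrow> (\<Prod>i<k. x - d * q ^ i) = x ^ k * qpoch (d / x) q k"
  by (induction k) (simp_all add: qpoch_Suc field_simps)

lemma real_choose_two: "real (k choose 2) = real k * (real k - 1) / 2"
  by (induction k) (simp_all add: numeral_2_eq_2 field_simps)

lemma inner_sum_orthonormal:
  fixes ket :: "nat \<Rightarrow> 'v::real_inner"
  assumes "orthonormal_basis N ket"
  shows "(\<Sum>l\<le>N. f l *\<^sub>R ket l) \<bullet> (\<Sum>l\<le>N. g l *\<^sub>R ket l) = (\<Sum>l\<le>N. f l * g l)"
proof -
  have "(\<Sum>l\<le>N. f l *\<^sub>R ket l) \<bullet> (\<Sum>l\<le>N. g l *\<^sub>R ket l) =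
      (\<Sum>l\<le>N. \<Sum>k\<le>N. if l = k then f l * g l else 0)"
    unfolding inner_sum_left inner_sum_right
    using assms by (intro sum.cong) (auto simp: orthonormal_basis_def)
  then show ?thesis
    by simp
qed

section \<open>Negative powers of q as parameters, and Gaussian binomial coefficients\<close>

context
  fixes q :: real
  assumes q: "0 < q" "q \<noteq> 1"
begin

lemma power_eq_1_iff_pos: "q ^ n = 1 \<longleftrightarrow> n = 0"
  using q by (metis less_eq_real_def power_0 power_eq_1_iff abs_of_pos real_norm_def gr0I)

lemma qpoch_q_nonzero [simp]: "qpoch q q n \<noteq> 0"
  using power_eq_1_iff_pos[of "Suc _"] by (induction n) (auto simp: qpoch_Suc)

text \<open>Since 1 - q^(i-n) = -q^(i-n) (1 - q^(n-i)), the factors are, up to signs and powers of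
  q, the last k factors of (q;q)_n.\<close>

lemma qpoch_inverse_power:
  assumes "k \<le> n"
  shows "qpoch (1 / q ^ n) q k =
    (-1) ^ k * q ^ (k choose 2) / q ^ (n * k) * qpoch q q n / qpoch q q (n - k)"
  using assms
proof (induction k)
  case (Suc k)
  then have *: "qpoch q q (n - k) = qpoch q q (n - Suc k) * (1 - q ^ (n - k))"
    by (metis Suc_diff_Suc Suc_le_lessD power_Suc qpoch_Suc)
  have "q ^ n = q ^ k * q ^ (n - k)"
    using Suc by (simp flip: power_add)
  then have **: "1 - 1 / q ^ n * q ^ k = (q ^ (n - k) - 1) * q ^ k / q ^ n"
    using q by (simp add: field_simps)
  have "1 - q ^ (n - k) \<noteq> 0"
    using Suc power_eq_1_iff_pos[of "n - k"] by auto
  then have "1 / qpoch q q (n - Suc k) = - ((q ^ (n - k) - 1) / qpoch q q (n - k))"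
    unfolding * by (simp add: minus_divide_left)
  then have "(-1) ^ Suc k * q ^ (Suc k choose 2) / q ^ (n * Suc k) * qpoch q q n / qpoch q q (n - Suc k) =
      (-1) ^ Suc k * q ^ (Suc k choose 2) / q ^ (n * Suc k) * qpoch q q n * - ((q ^ (n - k) - 1) / qpoch q q (n - k))"
    by (metis times_divide_eq_right mult_1_right)
  with Suc show ?case
    unfolding qpoch_Suc ** by (simp add: numeral_2_eq_2 power_add mult_ac)
qed (simp add: numeral_2_eq_2)

lemma qpoch_inverse_power_eq_0: "n < k \<Longrightarrow> qpoch (1 / q ^ n) q k = 0"
  using q by (auto simp: qpoch_def intro!: bexI[of _ n])

lemma qpoch_inverse_power_nonzero: "k \<le> n \<Longrightarrow> qpoch (1 / q ^ n) q k \<noteq> 0"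
  using q by (simp add: qpoch_inverse_power)

lemma qbinom_0 [simp]: "qbinom q n 0 = 1"
  by (simp add: qbinom_def)

lemma qbinom_Suc_self [simp]: "qbinom q n (Suc n) = 0"
  by (simp add: qbinom_def)

text \<open>For j < n put u = q^(n-j) and v = q^(j+1). The three coefficients are a common factor
  times 1 - uv, 1 - u and 1 - v, and 1 - uv = (1 - u) + u(1 - v) = v(1 - u) + (1 - v) gives both
  q-Pascal rules.\<close>

lemma qbinom_Suc_Suc:
  assumes "j \<le> n"
  shows "qbinom q (Suc n) (Suc j) = qbinom q n (Suc j) + q ^ (n - j) * qbinom q n j"
    and "qbinom q (Suc n) (Suc j) = q ^ Suc j * qbinom q n (Suc j) + qbinom q n j"
proof -
  have nz: "1 - q ^ Suc i \<noteq> 0" for i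
    using power_eq_1_iff_pos[of "Suc i"] by simp
  have S: "qpoch q q (Suc i) = qpoch q q i * (1 - q ^ Suc i)" for i
    by (simp add: qpoch_Suc)
  consider "j = n" | i where "n = Suc (j + i)"
    using assms by (metis le_neq_implies_less less_imp_Suc_add)
  then have "qbinom q (Suc n) (Suc j) = qbinom q n (Suc j) + q ^ (n - j) * qbinom q n j \<and>
    qbinom q (Suc n) (Suc j) = q ^ Suc j * qbinom q n (Suc j) + qbinom q n j"
  proof cases
    case 1
    then show ?thesis
      using nz[of n] by (simp add: qbinom_def)
  next
    case 2
    define p where
      "p = qpoch q q (Suc (j + i)) / (qpoch q q j * qpoch q q i * (1 - q ^ Suc j) * (1 - q ^ Suc i))"
    have "qbinom q (Suc n) (Suc j) = p * (1 - q ^ (Suc (Suc (j + i))))"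
      using 2 by (simp add: p_def qbinom_def S Suc_diff_le del: power_Suc)
    moreover have "qbinom q n (Suc j) = p * (1 - q ^ Suc i)"
      using 2 nz[of i] by (simp add: p_def qbinom_def S Suc_diff_le del: power_Suc)
    moreover have "qbinom q n j = p * (1 - q ^ Suc j)"
      using 2 nz[of j] by (simp add: p_def qbinom_def S Suc_diff_le del: power_Suc)
    moreover have "n - j = Suc i" "q ^ (Suc (Suc (j + i))) = q ^ Suc i * q ^ Suc j"
      using 2 by (simp_all add: power_add)
    ultimately show ?thesis
      by (simp only: ring_distribs mult_1_right) (simp add: algebra_simps del: power_Suc)
  qed
  then show "qbinom q (Suc n) (Suc j) = qbinom q n (Suc j) + q ^ (n - j) * qbinom q n j"
    and "qbinom q (Suc n) (Suc j) = q ^ Suc j * qbinom q n (Suc j) + qbinom q n j"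
    by auto
qed

section \<open>The q-Pascal rules under a sum, and the two q-Vandermonde sums\<close>

lemma sum_qbinom_Suc:
  "(\<Sum>j\<le>Suc n. qbinom q (Suc n) j * s j) =
     (\<Sum>j\<le>n. qbinom q n j * s j) + (\<Sum>j\<le>n. qbinom q n j * (q ^ (n - j) * s (Suc j)))"
  "(\<Sum>j\<le>Suc n. qbinom q (Suc n) j * s j) =
     (\<Sum>j\<le>n. qbinom q n j * (q ^ j * s j)) + (\<Sum>j\<le>n. qbinom q n j * s (Suc j))"
proof -
  \<comment> \<open>The added top term \<open>j = Suc n\<close> is zero by the default value of
    \<open>qbinom\<close>.\<close>
  have *: "(\<Sum>j\<le>n. qbinom q n j * t j) = t 0 + (\<Sum>j\<le>n. qbinom q n (Suc j) * t (Suc j))" for t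
    using sum.atMost_Suc[of "\<lambda>j. qbinom q n j * t j" n]
      sum.atMost_Suc_shift[of "\<lambda>j. qbinom q n j * t j" n] by simp
  have "(\<Sum>j\<le>Suc n. qbinom q (Suc n) j * s j) =
      s 0 + (\<Sum>j\<le>n. (qbinom q n (Suc j) + q ^ (n - j) * qbinom q n j) * s (Suc j))"
    by (simp add: sum.atMost_Suc_shift qbinom_Suc_Suc(1) del: sum.atMost_Suc)
  then show "(\<Sum>j\<le>Suc n. qbinom q (Suc n) j * s j) =
     (\<Sum>j\<le>n. qbinom q n j * s j) + (\<Sum>j\<le>n. qbinom q n j * (q ^ (n - j) * s (Suc j)))"
    unfolding *[of s] by (simp add: algebra_simps sum.distrib)
  have "(\<Sum>j\<le>Suc n. qbinom q (Suc n) j * s j) =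
      s 0 + (\<Sum>j\<le>n. (q ^ Suc j * qbinom q n (Suc j) + qbinom q n j) * s (Suc j))"
    by (simp add: sum.atMost_Suc_shift qbinom_Suc_Suc(2) del: sum.atMost_Suc power_Suc)
  then show "(\<Sum>j\<le>Suc n. qbinom q (Suc n) j * s j) =
     (\<Sum>j\<le>n. qbinom q n j * (q ^ j * s j)) + (\<Sum>j\<le>n. qbinom q n j * s (Suc j))"
    unfolding *[of "\<lambda>j. q ^ j * s j"] by (simp add: algebra_simps sum.distrib)
qed

text \<open>This is 2phi1(q^-n, x; wx; q, w q^n) = (w;q)_n / (wx;q)_n, cleared of denominators. The
  first Pascal rule calls the induction hypothesis at x and at xq and leaves (1 - wxq^n) - w(1 -
  x)q^n = 1 - wq^n.\<close>

lemma q_Vandermonde_1: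
  "(\<Sum>j\<le>n. qbinom q n j * ((-1) ^ j * q ^ (j choose 2) * w ^ j * qpoch x q j *
     qpoch (w * x * q ^ j) q (n - j))) = qpoch w q n"
proof (induction n arbitrary: x)
  case (Suc n)
  let ?s = "\<lambda>n x j. (-1) ^ j * q ^ (j choose 2) * w ^ j * qpoch x q j * qpoch (w * x * q ^ j) q (n - j)"
  have 1: "(\<Sum>j\<le>n. qbinom q n j * ?s (Suc n) x j) = (1 - w * x * q ^ n) * qpoch w q n"
    unfolding Suc[of x, symmetric] sum_distrib_left
  proof (rule sum.cong, goal_cases)
    case (2 j)
    then have "q ^ n = q ^ j * q ^ (n - j)"
      by (simp flip: power_add)
    with 2 show ?case
      by (simp add: Suc_diff_le qpoch_Suc mult_ac)
  qed simp
  have 2: "(\<Sum>j\<le>n. qbinom q n j * (q ^ (n - j) * ?s (Suc n) x (Suc j))) =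
    - w * (1 - x) * q ^ n * qpoch w q n"
    unfolding Suc[of "x * q", symmetric] sum_distrib_left
  proof (rule sum.cong, goal_cases)
    case (2 j)
    then have "q ^ n = q ^ j * q ^ (n - j)"
      by (simp flip: power_add)
    then show ?case
      by (simp add: qpoch_Suc_left numeral_2_eq_2 power_add mult_ac)
  qed simp
  show ?case
    unfolding sum_qbinom_Suc(1) 1 2 by (simp add: qpoch_Suc algebra_simps)
qed (simp add: numeral_2_eq_2)

text \<open>This is 2phi1(q^-n, x; d; q, q) = x^n (d/x;q)_n / (d;q)_n, cleared of denominators. The
  second Pascal rule calls the induction hypothesis at (x, d) and at (xq, dq) and leaves (1 - dq^n)
  - (1 - x) = x - dq^n.\<close>

lemma q_Vandermonde_2:
  "(\<Sum>j\<le>n. qbinom q n j * ((-1) ^ j * q ^ (Suc j choose 2) / q ^ (n * j) * qpoch x q j *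
     qpoch (d * q ^ j) q (n - j))) = (\<Prod>i<n. x - d * q ^ i)"
proof (induction n arbitrary: x d)
  case (Suc n)
  let ?s = "\<lambda>n x d j. (-1) ^ j * q ^ (Suc j choose 2) / q ^ (n * j) * qpoch x q j * qpoch (d * q ^ j) q (n - j)"
  have 1: "(\<Sum>j\<le>n. qbinom q n j * (q ^ j * ?s (Suc n) x d j)) =
      (1 - d * q ^ n) * (\<Prod>i<n. x - d * q ^ i)"
    unfolding Suc[of x d, symmetric] sum_distrib_left
  proof (rule sum.cong, goal_cases)
    case (2 j)
    then have "q ^ n = q ^ j * q ^ (n - j)"
      by (simp flip: power_add)
    with 2 q show ?case
      by (simp add: Suc_diff_le qpoch_Suc power_add mult_ac)
  qed simp
  have shift: "(\<Prod>i<n. x * q - d * q * q ^ i) = q ^ n * (\<Prod>i<n. x - d * q ^ i)"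
    by (induction n) (simp_all add: algebra_simps)
  have 2: "(\<Sum>j\<le>n. qbinom q n j * ?s (Suc n) x d (Suc j)) =
    - (1 - x) * (\<Prod>i<n. x - d * q ^ i)"
  proof -
    \<comment> \<open>Raising both n and j by one lowers the exponent of q by exactly n, which
      compensates the factor q^n in \<open>shift\<close>.\<close>
    have "(\<Sum>j\<le>n. qbinom q n j * ?s (Suc n) x d (Suc j)) =
        - (1 - x) / q ^ n * (\<Sum>j\<le>n. qbinom q n j * ?s n (x * q) (d * q) j)"
      unfolding sum_distrib_left
    proof (rule sum.cong, goal_cases)
      case (2 j)
      show ?case
        using q by (simp add: qpoch_Suc_left numeral_2_eq_2 power_add field_simps)
    qed simp
    also note Suc[of "x * q" "d * q"]
    also note shift
    finally show ?thesis
      using q by simp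
  qed
  show ?case
    unfolding sum_qbinom_Suc(2) 1 2 by (simp add: algebra_simps)
qed (simp add: numeral_2_eq_2)

section \<open>The transformation between terminating 3phi2 series\<close>

lemma qbinom_mult_qbinom:
  assumes "j + i \<le> n"
  shows "qbinom q n (j + i) * qbinom q (j + i) j = qbinom q n j * qbinom q (n - j) i"
  using assms by (simp add: qbinom_def)

text \<open>
  Expanding the factor containing \<open>x\<close> by the second Vandermonde sum leaves inner sums of the first
  kind. The right-hand side is symmetric in \<open>x\<close> and \<open>c\<close>.
\<close>

lemma q_transformation:
  assumes d: "\<And>k. k \<le> M \<Longrightarrow> qpoch d q k \<noteq> 0"
  shows "(\<Sum>k\<le>M. qbinom q M k * ((-1) ^ k * q ^ (k choose 2) * u ^ k * qpoch c q k *
            qpoch (u * c * q ^ k) q (M - k) * ((\<Prod>i<k. x - d * q ^ i) / qpoch d q k))) =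
         (\<Sum>j\<le>M. qbinom q M j * (u ^ j * qpoch u q (M - j) * qpoch x q j * qpoch c q j / qpoch d q j))"
proof -
  let ?g = "\<lambda>k. (-1) ^ k * q ^ (k choose 2) * u ^ k * qpoch c q k * qpoch (u * c * q ^ k) q (M - k)"
  let ?h = "\<lambda>k j. (-1) ^ j * q ^ (Suc j choose 2) / q ^ (k * j) * (qpoch x q j / qpoch d q j)"
  let ?t = "\<lambda>k j. qbinom q M k * ?g k * (qbinom q k j * ?h k j)"
  \<comment> \<open>Splitting (d;q)_k at j cancels the factor (dq^j;q)_(k-j) of the Vandermonde sum
    and leaves the denominator (d;q)_j, independent of k.\<close>
  have R: "(\<Prod>i<k. x - d * q ^ i) / qpoch d q k = (\<Sum>j\<le>k. qbinom q k j * ?h k j)" if "k \<le> M" for k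
    unfolding q_Vandermonde_2[symmetric] sum_divide_distrib
  proof (rule sum.cong, goal_cases)
    case (2 j)
    then show ?case
      using d[OF that] qpoch_split[of j k d q] by simp
  qed simp
  have "(\<Sum>k\<le>M. qbinom q M k * (?g k * ((\<Prod>i<k. x - d * q ^ i) / qpoch d q k))) =
      (\<Sum>k\<le>M. \<Sum>j\<le>k. ?t k j)"
    by (simp add: R sum_distrib_left mult.assoc)
  also have "\<dots> = (\<Sum>(k, j)\<in>(SIGMA k:{..M}. {..k}). ?t k j)"
    by (simp add: sum.Sigma)
  \<comment> \<open>Interchange of the two summations, with k = j + i.\<close>
  also have "\<dots> = (\<Sum>(j, i)\<in>(SIGMA j:{..M}. {..M - j}). ?t (j + i) j)"
    by (rule sum.reindex_bij_witness[of _ "\<lambda>(j, i). (j + i, j)" "\<lambda>(k, j). (j, k - j)"]) auto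
  also have "\<dots> = (\<Sum>j\<le>M. \<Sum>i\<le>M - j. ?t (j + i) j)"
    by (simp add: sum.Sigma)
  also have "\<dots> = (\<Sum>j\<le>M. qbinom q M j * (u ^ j * qpoch u q (M - j) * qpoch x q j * qpoch c q j / qpoch d q j))"
  proof (rule sum.cong, goal_cases)
    case (2 j)
    \<comment> \<open>The sum over i is the first Vandermonde sum of length M - j with w = u and x =
      c q^j, so it equals (u;q)_(M-j).\<close>
    have "(\<Sum>i\<le>M - j. ?t (j + i) j) =
      qbinom q M j * (u ^ j * qpoch x q j * qpoch c q j / qpoch d q j) *
      (\<Sum>i\<le>M - j. qbinom q (M - j) i * ((-1) ^ i * q ^ (i choose 2) * u ^ i * qpoch (c * q ^ j) q i *
         qpoch (u * (c * q ^ j) * q ^ i) q (M - j - i)))"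
      unfolding sum_distrib_left
    proof (rule sum.cong, goal_cases)
      case (2 i)
      then have le: "j + i \<le> M"
        using \<open>j \<in> {..M}\<close> by auto
      \<comment> \<open>This balance of exponents cancels the denominator q^((j+i)j) and leaves the
        weight q^(i choose 2) that the first Vandermonde sum requires.\<close>
      have ch: "(j + i choose 2) + (Suc j choose 2) = (i choose 2) + (j + i) * j"
        using choose_two_double[of j] choose_two_add[of j i] by (simp add: numeral_2_eq_2 algebra_simps)
      have pw: "q ^ (j + i choose 2) * q ^ (Suc j choose 2) = q ^ (i choose 2) * q ^ ((j + i) * j)"
        using ch by (metis power_add)
      have "?t (j + i) j = (qbinom q M (j + i) * qbinom q (j + i) j) *
          ((-1) ^ i * (q ^ (j + i choose 2) * q ^ (Suc j choose 2)) / q ^ ((j + i) * j) * u ^ (j + i) *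
           qpoch c q (j + i) * qpoch (u * c * q ^ (j + i)) q (M - (j + i)) * (qpoch x q j / qpoch d q j))"
        by (simp add: power_add mult_ac)
      also have "\<dots> = (qbinom q M j * qbinom q (M - j) i) *
          ((-1) ^ i * q ^ (i choose 2) * u ^ (j + i) *
           qpoch c q (j + i) * qpoch (u * c * q ^ (j + i)) q (M - (j + i)) * (qpoch x q j / qpoch d q j))"
        unfolding pw qbinom_mult_qbinom[OF le] using q by simp
      finally show ?case
        by (simp add: power_add qpoch_add mult_ac)
    qed simp
    then show ?case
      unfolding q_Vandermonde_1 by (simp add: mult_ac)
  qed simp
  finally show ?thesis
    by (simp add: mult.assoc)
qed

section \<open>From the transformation to the reversal formula for q-Hahn sums\<close>

lemma qpoch_inverse_power_div:
  "qpoch (1 / q ^ n) q k / qpoch q q k = qbinom q n k * (-1) ^ k * q ^ (k choose 2) / q ^ (n * k)"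
proof (cases "k \<le> n")
  case True
  then show ?thesis
    using q by (simp add: qpoch_inverse_power qbinom_def mult_ac)
next
  case False
  then show ?thesis
    by (simp add: qpoch_inverse_power_eq_0 qbinom_def)
qed

lemma sum_qbinom_extend:
  "n \<le> N \<Longrightarrow> (\<Sum>k\<le>n. qbinom q n k * f k) = (\<Sum>k\<le>N. qbinom q n k * f k)"
  by (rule sum.mono_neutral_left) (auto simp: qbinom_def)

text \<open>
  The series that \<open>q_transformation\<close> gives for \<open>G m p\<close> has coefficients symmetric in \<open>m\<close> and \<open>p\<close>
  because of the special value of \<open>d\<close>.
\<close>

lemma q_sum_symmetry:
  assumes le: "m \<le> N" "p \<le> N" and nz: "\<And>k. k \<le> N \<Longrightarrow> qpoch (u * c) q k \<noteq> 0"
  defines "G \<equiv> \<lambda>m p. \<Sum>j\<le>m. qbinom q m j *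
    (u ^ j * qpoch u q (m - j) * qpoch (1 / q ^ (N - p)) q j * qpoch c q j / qpoch (1 / q ^ N) q j)"
  shows "G m p / qpoch (u * c) q m = G p m / qpoch (u * c) q p"
proof -
  define R where "R = (\<lambda>p k. (\<Prod>i<k. 1 / q ^ (N - p) - 1 / q ^ N * q ^ i) / qpoch (1 / q ^ N) q k)"
  have d: "qpoch (1 / q ^ N) q k \<noteq> 0" if "k \<le> N" for k
    using qpoch_inverse_power_nonzero[OF that] .
  \<comment> \<open>After division by \<open>qpoch (u * c) q m\<close>, the parameters
    \<open>m\<close> and \<open>p\<close> enter only through
    \<open>qbinom q m k * R p k\<close>.\<close>
  have G: "G m p / qpoch (u * c) q m = (\<Sum>k\<le>N. qbinom q m k * R p k *
      ((-1) ^ k * q ^ (k choose 2) * u ^ k * qpoch c q k / qpoch (u * c) q k))"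
    if le: "m \<le> N" "p \<le> N" for m p
  proof -
    have "G m p = (\<Sum>k\<le>m. qbinom q m k * ((-1) ^ k * q ^ (k choose 2) * u ^ k * qpoch c q k *
            qpoch (u * c * q ^ k) q (m - k) * R p k))"
      unfolding G_def R_def by (rule q_transformation[symmetric]) (use d le in auto)
    also have "\<dots> = (\<Sum>k\<le>m. qbinom q m k * (qpoch (u * c) q m * R p k *
      ((-1) ^ k * q ^ (k choose 2) * u ^ k * qpoch c q k / qpoch (u * c) q k)))"
    proof (rule sum.cong, goal_cases)
      case (2 k)
      then show ?case
        using qpoch_split[of k m "u * c" q] nz[of k] le by simp
    qed simp
    also have "\<dots> = qpoch (u * c) q m * (\<Sum>k\<le>N. qbinom q m k * R p k *
      ((-1) ^ k * q ^ (k choose 2) * u ^ k * qpoch c q k / qpoch (u * c) q k))"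
      unfolding sum_qbinom_extend[OF le(1)] sum_distrib_left by (simp add: mult_ac)
    finally show ?thesis
      using nz le by simp
  qed
  have R: "qbinom q m k * R p k = (if k \<le> p \<and> k \<le> m then
      qpoch q q m * qpoch q q p * qpoch q q (N - k) /
        (qpoch q q k * qpoch q q (m - k) * qpoch q q (p - k) * qpoch q q N) else 0)"
    if le: "m \<le> N" "p \<le> N" "k \<le> N" for m p k
  proof -
    \<comment> \<open>Here d/x = q^-N / q^-(N-p) = q^-p. Hence \<open>R p k\<close> contributes
      (q;q)_p / (q;q)_(p-k), the counterpart of what \<open>qbinom q m k\<close> contributes for
      \<open>m\<close>.\<close>
    have "q ^ N = q ^ (N - p) * q ^ p"
      using le by (simp flip: power_add)
    then have "1 / q ^ N / (1 / q ^ (N - p)) = 1 / q ^ p"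
      using q by simp
    have "q ^ (N * k) = q ^ ((N - p) * k) * q ^ (p * k)"
      using \<open>q ^ N = _\<close> by (simp add: power_mult power_mult_distrib)
    have R: "R p k = (1 / q ^ (N - p)) ^ k * qpoch (1 / q ^ p) q k / qpoch (1 / q ^ N) q k"
      unfolding R_def by (subst prod_diff_eq_qpoch) (use q \<open>1 / q ^ N / _ = _\<close> in simp_all)
    show ?thesis
    proof (cases "k \<le> p \<and> k \<le> m")
      case True
      then show ?thesis
        using q le \<open>q ^ (N * k) = _\<close>
        by (simp add: R qpoch_inverse_power qbinom_def power_divide power_mult)
    next
      case False
      then show ?thesis
        by (auto simp: R qpoch_inverse_power_eq_0 qbinom_def)
    qed
  qed
  have "qbinom q m k * R p k = qbinom q p k * R m k" if "k \<le> N" for k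
    unfolding R[OF le that] R[OF le(2,1) that] by (simp add: mult_ac)
  then show ?thesis
    unfolding G[OF le] G[OF le(2,1)] by (intro sum.cong) auto
qed

text \<open>Both sides are reduced to sums \<open>G\<close>. Reversing the factors with parameter y
  turns the q-Hahn sum into \<open>G u1 m (N - n)\<close>, \<open>q_sum_symmetry\<close> swaps m
  with N - n, a termwise comparison trades \<open>u1\<close> for \<open>u2\<close>, and a further
  use of \<open>q_transformation\<close> reaches the series with denominators (w;q)_k.\<close>

lemma q_hahn_reversal:
  fixes w c y :: real
  assumes le: "m \<le> N" "n \<le> N"
    and y: "y * w * q ^ N = q" "c \<noteq> 0"
    and e: "e = w * q ^ (N - m) * c"
    and nz_y: "\<And>k. k \<le> N \<Longrightarrow> qpoch y q k \<noteq> 0"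
    and nz_w: "\<And>k. k \<le> N \<Longrightarrow> qpoch w q k \<noteq> 0"
    and nz_e: "\<And>k. k \<le> N \<Longrightarrow> qpoch e q k \<noteq> 0"
  shows "(\<Sum>k\<le>N. qpoch (1 / q ^ (N - m)) q k * qpoch (1 / q ^ (N - n)) q k * qpoch (1 / (q ^ N * c)) q k
            / (qpoch q q k * qpoch w q k * qpoch (1 / q ^ N) q k) * (q ^ (N - m) * (w * q ^ (N - n) * c)) ^ k)
          * qpoch w q (N - n)
       = qpoch y q m * qpoch e q (N - n) / qpoch e q m * ((-1) ^ m * (w * q ^ (N - m)) ^ m * q ^ (m choose 2)) *
         (\<Sum>k\<le>m. (qpoch (1 / q ^ m) q k * qpoch c q k * qpoch (1 / q ^ n) q k)
            / (qpoch y q k * qpoch (1 / q ^ N) q k) * (q ^ k / qpoch q q k))"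
    (is "?\<Phi> * _ = _ * ?K * ?Q")
proof -
  define u1 u2 where "u1 = w * q ^ (N - m)" and "u2 = w * q ^ (N - n)"
  define G where "G = (\<lambda>u m p. \<Sum>j\<le>m. qbinom q m j *
    (u ^ j * qpoch u q (m - j) * qpoch (1 / q ^ (N - p)) q j * qpoch c q j / qpoch (1 / q ^ N) q j))"
  have d: "qpoch (1 / q ^ N) q k \<noteq> 0" if "k \<le> N" for k
    using qpoch_inverse_power_nonzero[OF that] .
  have u1: "y * u1 * q ^ m = q"
    using y le by (simp add: u1_def mult.assoc flip: power_add)
  \<comment> \<open>The quotient (y;q)_m / (y;q)_k = (yq^k;q)_(m-k) is reversed into (u1;q)_(m-k),
    by \<open>y * u1 * q ^ m = q\<close>.\<close>
  have G1: "qpoch y q m * ?K * ?Q = G u1 m (N - n)"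
    unfolding G_def sum_distrib_left
  proof (rule sum.cong, goal_cases)
    case (2 k)
    define i where "i = m - k"
    have m: "m = k + i" using 2 by (simp add: i_def)
    have "u1 * (y * q ^ k) * q ^ i = q"
      using u1 by (simp add: m power_add mult_ac)
    then have rev: "qpoch u1 q i = (-1) ^ i * u1 ^ i * q ^ (i choose 2) * qpoch (y * q ^ k) q i"
      by (rule qpoch_reverse) (use q in simp)
    have "(m choose 2) + (k choose 2) + k = (i choose 2) + m * k"
      using choose_two_double[of k] by (simp add: m choose_two_add algebra_simps)
    then have pw: "q ^ (m choose 2) * (q ^ (k choose 2) * q ^ k) = q ^ (i choose 2) * q ^ (m * k)"
      by (metis power_add add.assoc)
    have "qpoch y q m * ?K * ((qpoch (1 / q ^ m) q k * qpoch c q k * qpoch (1 / q ^ n) q k)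
            / (qpoch y q k * qpoch (1 / q ^ N) q k) * (q ^ k / qpoch q q k)) =
          qpoch y q m / qpoch y q k * ((-1) ^ m * u1 ^ m * q ^ (m choose 2)) *
          (qpoch (1 / q ^ m) q k / qpoch q q k * q ^ k) *
          (qpoch c q k * qpoch (1 / q ^ n) q k / qpoch (1 / q ^ N) q k)"
      by (simp add: u1_def mult_ac)
    also have "\<dots> = qbinom q m k * (qpoch y q m / qpoch y q k) * ((-1) ^ m * (-1) ^ k) * u1 ^ m *
          (q ^ (m choose 2) * (q ^ (k choose 2) * q ^ k)) / q ^ (m * k) *
          (qpoch c q k * qpoch (1 / q ^ n) q k / qpoch (1 / q ^ N) q k)"
      unfolding qpoch_inverse_power_div by (simp add: mult_ac)
    also have "\<dots> = qbinom q m k * (u1 ^ k * qpoch u1 q i * qpoch (1 / q ^ n) q k * qpoch c q k / qpoch (1 / q ^ N) q k)"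
      unfolding pw rev using q qpoch_add[of y q k i] nz_y[of k] 2 le
      by (simp add: m power_add mult_ac)
    finally show ?case
      using le by (simp add: i_def)
  qed simp
  have G2: "G u1 m (N - n) / qpoch e q m = G u1 (N - n) m / qpoch e q (N - n)"
    unfolding G_def e u1_def by (rule q_sum_symmetry) (use le nz_e e in auto)
  have G3: "qpoch w q (N - m) * G u1 (N - n) m = qpoch w q (N - n) * G u2 (N - m) n"
  proof -
    have "qpoch w q (N - m) * (qbinom q (N - n) j *
        (u1 ^ j * qpoch u1 q (N - n - j) * qpoch (1 / q ^ (N - m)) q j * qpoch c q j / qpoch (1 / q ^ N) q j)) =
      qpoch w q (N - n) * (qbinom q (N - m) j *
        (u2 ^ j * qpoch u2 q (N - m - j) * qpoch (1 / q ^ (N - n)) q j * qpoch c q j / qpoch (1 / q ^ N) q j))" for j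
    proof (cases "j \<le> N - n \<and> j \<le> N - m")
      case True
      \<comment> \<open>Equal total lengths: both products below are the single symbol (w;q) of
        length 2N - m - n - j.\<close>
      have "N - m + (N - n - j) = N - n + (N - m - j)"
        using True le by arith
      then have *: "qpoch w q (N - m) * qpoch u1 q (N - n - j) = qpoch w q (N - n) * qpoch u2 q (N - m - j)"
        unfolding u1_def u2_def by (metis qpoch_add)
      have **: "u1 ^ j = w ^ j * q ^ ((N - m) * j)" "u2 ^ j = w ^ j * q ^ ((N - n) * j)"
        by (simp_all add: u1_def u2_def power_mult_distrib power_mult)
      have "qbinom q (N - n) j * (u1 ^ j * qpoch (1 / q ^ (N - m)) q j) =
          qbinom q (N - m) j * (u2 ^ j * qpoch (1 / q ^ (N - n)) q j)"
        using True q by (simp add: ** qpoch_inverse_power qbinom_def) (simp add: mult_ac)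
      with * show ?thesis
        by (smt (verit, ccfv_threshold) mult.assoc mult.commute times_divide_eq_right)
    next
      case False
      then show ?thesis
        by (auto simp: qpoch_inverse_power_eq_0 qbinom_def)
    qed
    then show ?thesis
      unfolding G_def sum_qbinom_extend[OF diff_le_self] sum_distrib_left by (intro sum.cong refl)
  qed
  have G4: "G u2 (N - m) n = qpoch w q (N - m) * ?\<Phi>"
  proof -
    have u2w: "u2 * (1 / q ^ (N - n)) = w"
      using q by (simp add: u2_def)
    \<comment> \<open>The symmetry of the right-hand side of \<open>q_transformation\<close> is
      exploited: c now plays the role of x, and q^-(N-n) that of c.\<close>
    have "G u2 (N - m) n = (\<Sum>j\<le>N - m. qbinom q (N - m) j *
        (u2 ^ j * qpoch u2 q (N - m - j) * qpoch c q j * qpoch (1 / q ^ (N - n)) q j / qpoch (1 / q ^ N) q j))"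
      by (simp add: G_def mult_ac)
    also have "\<dots> = (\<Sum>k\<le>N - m. qbinom q (N - m) k * ((-1) ^ k * q ^ (k choose 2) * u2 ^ k *
            qpoch (1 / q ^ (N - n)) q k * qpoch (u2 * (1 / q ^ (N - n)) * q ^ k) q (N - m - k) *
            ((\<Prod>i<k. c - 1 / q ^ N * q ^ i) / qpoch (1 / q ^ N) q k)))"
      by (rule q_transformation[symmetric]) (use d in auto)
    also have "\<dots> = (\<Sum>k\<le>N - m. qbinom q (N - m) k * (qpoch w q (N - m) * ((-1) ^ k * q ^ (k choose 2) *
            qpoch (1 / q ^ (N - n)) q k * qpoch (1 / (q ^ N * c)) q k / (qpoch w q k * qpoch (1 / q ^ N) q k) *
            (u2 * c) ^ k)))"
      unfolding u2w
    proof (rule sum.cong, goal_cases)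
      case (2 k)
      then show ?case
        unfolding prod_diff_eq_qpoch[OF y(2)]
        using qpoch_split[of k "N - m" w q] nz_w[of k]
        by (simp add: power_mult_distrib)
    qed simp
    also have "\<dots> = qpoch w q (N - m) * ?\<Phi>"
      unfolding sum_qbinom_extend[OF diff_le_self] sum_distrib_left
    proof (rule sum.cong, goal_cases)
      case (2 k)
      have *: "qpoch (1 / q ^ (N - m)) q k =
          qbinom q (N - m) k * ((-1) ^ k * q ^ (k choose 2)) * qpoch q q k / (q ^ (N - m)) ^ k"
        unfolding power_mult[symmetric]
        using qpoch_inverse_power_div[of "N - m" k] qpoch_q_nonzero[of k] by (simp add: divide_eq_eq)
      show ?case
        unfolding * using q qpoch_q_nonzero[of k]
        by (simp add: u2_def power_mult_distrib mult_ac)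
    qed simp
    finally show ?thesis .
  qed
  \<comment> \<open>The intermediate sums are eliminated over abstract real numbers, which keeps the
    large expressions opaque.\<close>
  have combine: "\<Phi> * wn = Y * en / em * K * Q"
    if "Y * K * Q = G1" "G1 / em = G2 / en" "wm * G2 = wn * G3" "G3 = wm * \<Phi>"
      "wm \<noteq> 0" "em \<noteq> 0" "en \<noteq> 0" for \<Phi> Y K Q G1 G2 G3 wm wn em en :: real
  proof -
    have "wm * G2 = wm * (wn * \<Phi>)"
      using that(3,4) by simp
    with that(5) have "G2 = wn * \<Phi>"
      by simp
    then have "\<Phi> * wn = G1 / em * en"
      using that(2,7) by simp
    then show ?thesis
      using that(1) by (simp add: mult_ac)
  qed
  show ?thesis
    by (rule combine[OF G1 G2 G3 G4]) (use nz_w nz_e le in simp_all)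
qed

section \<open>Real powers of q and the normalization factors of the eigenvectors\<close>

lemma powr_minus_real: "q powr - real n = 1 / q ^ n"
  using q by (simp add: powr_minus powr_realpow divide_inverse)

lemma powr_real_diff: "n \<le> N \<Longrightarrow> q powr (real n - real N) = 1 / q ^ (N - n)"
  using powr_minus_real[of "N - n"] by (simp add: of_nat_diff)

text \<open>A normalizing denominator of \<open>f_star_vec\<close> and, with N - n for n, of
  \<open>f_vec\<close>. It is the source of the sign and of the half-integral quadratic
  exponents.\<close>

lemma qpoch_inverse_power_self:
  "qpoch (1 / q ^ n) q n = (-1) ^ n * q powr (- real n * (real n + 1) / 2) * qpoch q q n"
proof -
  have "q ^ (n choose 2) / q ^ (n * n) = q powr (real (n choose 2) - real (n * n))"
    unfolding powr_diff powr_realpow[OF q(1)] ..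
  also have "real (n choose 2) - real (n * n) = - real n * (real n + 1) / 2"
    by (simp add: real_choose_two field_simps)
  finally have pw: "q ^ (n choose 2) / q ^ (n * n) = q powr (- real n * (real n + 1) / 2)" .
  show ?thesis
    unfolding pw[symmetric] using qpoch_inverse_power[of n n] by simp
qed

text \<open>Normalization of \<open>e_vec\<close> and, with N - n for n, of
  \<open>e_star_vec\<close>. In the quotient the signs and the powers q^(n choose 2) cancel.\<close>

lemma qpoch_ratio_inverse_power:
  assumes "n \<le> N"
  shows "qpoch q q n * qpoch (1 / q ^ N) q n / qpoch (1 / q ^ n) q n =
    q powr (real n * (real n - real N)) * qpoch q q N / qpoch q q (N - n)"
proof -
  have "q powr (real n * (real n - real N)) = q ^ (n * n) / q ^ (N * n)"
    unfolding powr_realpow[OF q(1), symmetric] powr_diff[symmetric]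
    by (rule arg_cong[of _ _ "(powr) q"]) (simp add: algebra_simps)
  then show ?thesis
    using q assms by (simp add: qpoch_inverse_power)
qed

section \<open>The two families of scalar products\<close>

lemma e_inner_f_star:
  fixes A B \<alpha> \<beta> \<mu> :: real and ket :: "nat \<Rightarrow> 'v::real_inner"
  assumes a: "\<forall>i<N. a i \<noteq> 0"
    and ket: "orthonormal_basis N ket"
    and A: "A = q powr (\<mu> - \<beta> - 1)"
    and B: "B = q powr (- \<mu> - \<beta> - 1)"
    and le: "m \<le> N" "n \<le> N"
  shows "e_vec ket a q N \<alpha> \<beta> m \<bullet> f_star_vec ket a q N \<alpha> \<beta> \<mu> n =
        (\<Prod>i<n. a i) / (\<Prod>i<m. a i)
        * q powr (real m * (\<alpha> - \<beta> - real N + real m - 1)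
                  + real n * (\<beta> - \<alpha> + real n / 2 + 1 / 2))
        * (qpoch q q N * (- 1) ^ n / (qpoch q q n * qpoch q q (N - m)))
        * (qpoch (A * q) q n / qpoch (A * B * q ^ (m + 1)) q m)
        * q_hahn m (q powr - real n) A B N q"
proof -
  have y: "A * q = q powr (\<mu> - \<beta>)"
    using q by (simp add: A powr_diff)
  have c: "A * B * q ^ (m + 1) = q powr (real m - 2 * \<beta> - 1)"
    unfolding A B powr_realpow[OF q(1), symmetric] powr_add[symmetric]
    by (rule arg_cong[of _ _ "(powr) q"]) simp
  define c where "c = q powr (real m - 2 * \<beta> - 1)"
  define y where "y = q powr (\<mu> - \<beta>)"
  define t where "t = (\<lambda>k. (qpoch (1 / q ^ m) q k * qpoch c q k * qpoch (1 / q ^ n) q k)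
            / (qpoch y q k * qpoch (1 / q ^ N) q k) * (q ^ k / qpoch q q k))"
  \<comment> \<open>Terms with k > m vanish because of (q^-m;q)_k, so the q-Hahn sum may run over
    all basis indices.\<close>
  have Q: "q_hahn m (q powr - real n) A B N q = (\<Sum>k\<le>N. t k)"
    unfolding q_hahn_def c y powr_minus_real t_def c_def y_def
    by (rule sum.mono_neutral_left) (use le q in \<open>auto simp: qpoch_inverse_power_eq_0\<close>)
  define K where "K = (\<Prod>i<n. a i) / (\<Prod>i<m. a i) *
      (q powr ((\<alpha> - \<beta> - 1) * real m) * q powr ((\<beta> - \<alpha>) * real n)) *
      (qpoch q q m * qpoch (1 / q ^ N) q m / qpoch (1 / q ^ m) q m) *
      (1 / qpoch (1 / q ^ n) q n) * (qpoch y q n / qpoch c q m)"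
  have "e_vec ket a q N \<alpha> \<beta> m \<bullet> f_star_vec ket a q N \<alpha> \<beta> \<mu> n = (\<Sum>k\<le>N. K * t k)"
    unfolding e_vec_def f_star_vec_def inner_sum_orthonormal[OF ket]
  proof (rule sum.cong, goal_cases)
    case (2 k)
    have nz: "(\<Prod>i<k. a i) \<noteq> 0"
      using a 2 by simp
    \<comment> \<open>The powers of q carried by the two vectors combine to the factor q^k of the
      q-Hahn summand.\<close>
    have "(\<alpha> - \<beta> - 1) * real k + (\<beta> - \<alpha>) * real k = - real k"
      by (simp add: algebra_simps)
    then have pw: "q powr ((\<alpha> - \<beta> - 1) * real k) * q powr ((\<beta> - \<alpha>) * real k) = 1 / q ^ k"
      by (simp add: powr_minus_real flip: powr_add)
    have pw': "q ^ k = 1 / (q powr ((\<alpha> - \<beta> - 1) * real k) * q powr ((\<beta> - \<alpha>) * real k))"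
      unfolding pw by simp
    show ?case
      unfolding K_def t_def pw' powr_minus_real c_def[symmetric] y_def[symmetric]
      using nz by (simp add: mult_ac)
  qed simp
  also have "\<dots> = K * q_hahn m (q powr - real n) A B N q"
    by (simp add: Q sum_distrib_left)
  also have "K = (\<Prod>i<n. a i) / (\<Prod>i<m. a i)
        * (q powr ((\<alpha> - \<beta> - 1) * real m) * q powr ((\<beta> - \<alpha>) * real n) *
            q powr (real m * (real m - real N)) / q powr (- real n * (real n + 1) / 2))
        * (qpoch q q N * (- 1) ^ n / (qpoch q q n * qpoch q q (N - m)))
        * (qpoch (A * q) q n / qpoch (A * B * q ^ (m + 1)) q m)"
    unfolding K_def qpoch_ratio_inverse_power[OF le(1)]
    unfolding qpoch_inverse_power_self c y c_def y_def
    \<comment> \<open>The parity split identifies 1 / (-1)^n with (-1)^n.\<close>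
    by (cases "even n") (simp_all add: mult_ac)
  also have "q powr ((\<alpha> - \<beta> - 1) * real m) * q powr ((\<beta> - \<alpha>) * real n) *
            q powr (real m * (real m - real N)) / q powr (- real n * (real n + 1) / 2) =
      q powr (real m * (\<alpha> - \<beta> - real N + real m - 1) + real n * (\<beta> - \<alpha> + real n / 2 + 1 / 2))"
    unfolding powr_add[symmetric] powr_diff[symmetric]
    by (rule arg_cong[of _ _ "(powr) q"]) (simp add: field_simps)
  finally show ?thesis .
qed

text \<open>With k = N - l the scalar product becomes the 3phi2 series of
  \<open>q_hahn_reversal\<close>. What remains is to collect powers of q and signs.\<close>

lemma e_star_inner_f:
  fixes A B \<alpha> \<beta> \<mu> :: real and ket :: "nat \<Rightarrow> 'v::real_inner"
  assumes a: "\<forall>i<N. a i \<noteq> 0"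
    and ket: "orthonormal_basis N ket"
    and A: "A = q powr (\<mu> - \<beta> - 1)"
    and B: "B = q powr (- \<mu> - \<beta> - 1)"
    and den_f: "\<forall>l\<le>N. qpoch (q powr (\<beta> - \<mu> - real N + 1)) q (N - l) \<noteq> 0"
    and den_Q: "\<forall>k\<le>N. qpoch (A * q) q k \<noteq> 0"
    and den_B: "\<forall>m\<le>N. qpoch (B * q) q m \<noteq> 0"
    and le: "m \<le> N" "n \<le> N"
  shows "e_star_vec ket a q N \<alpha> \<beta> m \<bullet> f_vec ket a q N \<alpha> \<beta> \<mu> n =
        (\<Prod>i\<in>{n..<N}. a i) / (\<Prod>i\<in>{m..<N}. a i)
        * A powr (real N - real m - real n)
        * q powr (real m * (\<beta> - \<alpha> + real N - real m)
                  + real n * (\<alpha> - \<beta> - real n / 2 - 3 / 2) + real N)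
        * (qpoch q q N * (- 1) ^ n * qpoch (A * q) q m
           / (qpoch q q m * qpoch q q (N - n) * qpoch (B * q) q m))
        * (qpoch (B * q) q (N - n) / qpoch (A * B * q ^ (2 * m + 2)) q (N - m))
        * q_hahn m (q powr - real n) A B N q"
proof -
  \<comment> \<open>\<open>c\<close>, \<open>y\<close>, \<open>e\<close>, \<open>v\<close> are A B
    q^(m+1), A q, B q and A B q^(2m+2); \<open>w\<close> is the denominator parameter of
    \<open>f_vec\<close>, tied to \<open>y\<close> by \<open>y * w * q ^ N = q\<close>.\<close>
  define c y e w v where "c = q powr (real m - 2 * \<beta> - 1)" and "y = q powr (\<mu> - \<beta>)"
    and "e = q powr (- \<mu> - \<beta>)" and "w = q powr (\<beta> - \<mu> - real N + 1)"
    and "v = q powr (2 * real m - 2 * \<beta>)"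
  have y: "A * q = y"
    using q by (simp add: A y_def powr_diff)
  have e: "B * q = e"
    using q by (simp add: B e_def powr_diff)
  have c: "A * B * q ^ (m + 1) = c"
    unfolding A B c_def powr_realpow[OF q(1), symmetric] powr_add[symmetric]
    by (rule arg_cong[of _ _ "(powr) q"]) simp
  have v: "A * B * q ^ (2 * m + 2) = v"
    unfolding A B v_def powr_realpow[OF q(1), symmetric] powr_add[symmetric]
    by (rule arg_cong[of _ _ "(powr) q"]) simp
  have c': "q powr (- real N - real m + 2 * \<beta> + 1) = 1 / (q ^ N * c)"
  proof -
    have "q powr (- real N - real m + 2 * \<beta> + 1) * (q ^ N * c) = 1"
      using q by (simp add: c_def flip: powr_realpow powr_add)
    then show ?thesis
      using q by (simp add: c_def field_simps)
  qed
  have w1: "w * q ^ (N - m) = q powr (\<beta> - \<mu> - real m + 1)"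
    using q le by (simp add: w_def of_nat_diff algebra_simps flip: powr_realpow powr_add)
  define \<Phi> where "\<Phi> = (\<lambda>k. qpoch (1 / q ^ (N - m)) q k * qpoch (1 / q ^ (N - n)) q k * qpoch (1 / (q ^ N * c)) q k
            / (qpoch q q k * qpoch w q k * qpoch (1 / q ^ N) q k) * (q ^ (N - m) * (w * q ^ (N - n) * c)) ^ k)"
  define K where "K = (\<Prod>i\<in>{n..<N}. a i) / (\<Prod>i\<in>{m..<N}. a i) *
      (q powr ((\<alpha> + \<beta> - real N) * real (N - m)) / q powr ((\<alpha> - \<mu> - real n) * real (N - n))) *
      (qpoch q q (N - m) * qpoch (1 / q ^ N) q (N - m) / qpoch (1 / q ^ (N - m)) q (N - m)) *
      (1 / qpoch (1 / q ^ (N - n)) q (N - n)) * (1 / qpoch (1 / (q ^ N * c)) q (N - m))"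
  define X where "X = q powr ((\<alpha> + \<beta> - real N) * real (N - m)) / q powr ((\<alpha> - \<mu> - real n) * real (N - n)) *
       q powr (real (N - m) * (real (N - m) - real N)) / q powr (- real (N - n) * (real (N - n) + 1) / 2)
       / (q powr ((- real N - real m + 2 * \<beta> + 1) * real (N - m)) * q powr (real (N - m choose 2)))"
  have "e_star_vec ket a q N \<alpha> \<beta> m \<bullet> f_vec ket a q N \<alpha> \<beta> \<mu> n = (\<Sum>l\<le>N. K * qpoch w q (N - n) * \<Phi> (N - l))"
    unfolding e_star_vec_def f_vec_def inner_sum_orthonormal[OF ket]
  proof (rule sum.cong, goal_cases)
    case (2 l)
    define k where "k = N - l"
    have nz: "(\<Prod>i\<in>{l..<N}. a i) \<noteq> 0"
      using a by simp
    \<comment> \<open>The index-dependent powers of q in the two vectors must combine to the k-th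
      power of the argument of the 3phi2 series.\<close>
    have "q ^ (N - m) * (w * q ^ (N - n) * c) = q powr (real N - \<beta> - \<mu> - real n)"
      using q le by (simp add: w_def c_def of_nat_diff algebra_simps flip: powr_realpow powr_add)
    then have "(q ^ (N - m) * (w * q ^ (N - n) * c)) ^ k = q powr ((real N - \<beta> - \<mu> - real n) * real k)"
      using q by (simp add: powr_powr flip: powr_realpow)
    also have "\<dots> = q powr ((\<alpha> - \<mu> - real n) * real k) / q powr ((\<alpha> + \<beta> - real N) * real k)"
      unfolding powr_diff[symmetric] by (rule arg_cong[of _ _ "(powr) q"]) (simp add: field_simps)
    finally have pw: "(q ^ (N - m) * (w * q ^ (N - n) * c)) ^ k = \<dots>" .
    show ?case
      unfolding K_def \<Phi>_def powr_minus_real powr_real_diff[OF le(1)] powr_real_diff[OF le(2)] c'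
        w_def[symmetric] k_def[symmetric] pw
      using nz by (simp add: mult_ac)
  qed simp
  also have "\<dots> = K * ((\<Sum>k\<le>N. \<Phi> k) * qpoch w q (N - n))"
  proof -
    have "(\<Sum>l\<le>N. \<Phi> (N - l)) = (\<Sum>k\<le>N. \<Phi> k)"
      by (rule sum.reindex_bij_witness[of _ "\<lambda>k. N - k" "\<lambda>k. N - k"]) auto
    then show ?thesis
      unfolding sum_distrib_left[symmetric] by (simp add: mult_ac)
  qed
  also have "(\<Sum>k\<le>N. \<Phi> k) * qpoch w q (N - n) = qpoch y q m * qpoch e q (N - n) / qpoch e q m *
      ((-1) ^ m * (w * q ^ (N - m)) ^ m * q ^ (m choose 2)) * q_hahn m (q powr - real n) A B N q"
    unfolding \<Phi>_def q_hahn_def c y powr_minus_real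
  proof (rule q_hahn_reversal[OF le])
    show "y * w * q ^ N = q"
      using q by (simp add: y_def w_def flip: powr_realpow powr_add)
    show "c \<noteq> 0"
      using q by (simp add: c_def)
    show "e = w * q ^ (N - m) * c"
      unfolding w1 e_def c_def powr_add[symmetric] by (rule arg_cong[of _ _ "(powr) q"]) simp
    show "qpoch w q k \<noteq> 0" if "k \<le> N" for k
      using den_f[rule_format, of "N - k"] that by (simp add: w_def)
  qed (use den_Q den_B in \<open>auto simp: y e\<close>)
  also have "K = (\<Prod>i\<in>{n..<N}. a i) / (\<Prod>i\<in>{m..<N}. a i) *
      X *
      ((-1) ^ (N - n) * (-1) ^ (N - m)) *
      (qpoch q q N / (qpoch q q m * qpoch q q (N - n) * qpoch v q (N - m)))"
  proof -
    \<comment> \<open>Reversing the normalizing symbol of \<open>e_star_vec\<close> produces the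
      denominator parameter A B q^(2m+2) of the claim.\<close>
    have "1 / (q ^ N * c) * v * q ^ (N - m) = q"
      unfolding c'[symmetric] using q le by (simp add: v_def of_nat_diff flip: powr_realpow powr_add)
    then have "qpoch (1 / (q ^ N * c)) q (N - m) =
        (-1) ^ (N - m) * (1 / (q ^ N * c)) ^ (N - m) * q ^ (N - m choose 2) * qpoch v q (N - m)"
      by (rule qpoch_reverse) (use q in simp)
    also have "(1 / (q ^ N * c)) ^ (N - m) = q powr ((- real N - real m + 2 * \<beta> + 1) * real (N - m))"
      unfolding c'[symmetric] using q by (simp add: powr_powr flip: powr_realpow)
    also have "q ^ (N - m choose 2) = q powr real (N - m choose 2)"
      using q by (simp add: powr_realpow)
    finally have rev: "qpoch (1 / (q ^ N * c)) q (N - m) = (-1) ^ (N - m) *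
        q powr ((- real N - real m + 2 * \<beta> + 1) * real (N - m)) * q powr real (N - m choose 2) *
        qpoch v q (N - m)" .
    show ?thesis
      unfolding K_def X_def qpoch_ratio_inverse_power[OF diff_le_self] rev
      unfolding qpoch_inverse_power_self
      using le by (cases "even (N - m)"; cases "even (N - n)") (simp_all add: mult_ac)
  qed
  finally have main: "e_star_vec ket a q N \<alpha> \<beta> m \<bullet> f_vec ket a q N \<alpha> \<beta> \<mu> n =
      (\<Prod>i\<in>{n..<N}. a i) / (\<Prod>i\<in>{m..<N}. a i) * X * ((-1) ^ (N - n) * (-1) ^ (N - m)) *
      (qpoch q q N / (qpoch q q m * qpoch q q (N - n) * qpoch v q (N - m))) *
      (qpoch y q m * qpoch e q (N - n) / qpoch e q m *
        ((-1) ^ m * (w * q ^ (N - m)) ^ m * q ^ (m choose 2)) * q_hahn m (q powr - real n) A B N q)" .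
  have W: "(w * q ^ (N - m)) ^ m = q powr ((\<beta> - \<mu> - real m + 1) * real m)"
    unfolding w1 using q by (simp add: powr_powr flip: powr_realpow)
  have C: "q ^ (m choose 2) = q powr (real (m choose 2))"
    using q by (simp add: powr_realpow)
  \<comment> \<open>Everything is written as one real power of q, so only a polynomial identity
    between exponents is left.\<close>
  have pw: "X * ((w * q ^ (N - m)) ^ m * q ^ (m choose 2)) =
      A powr (real N - real m - real n) * q powr (real m * (\<beta> - \<alpha> + real N - real m)
                  + real n * (\<alpha> - \<beta> - real n / 2 - 3 / 2) + real N)"
    unfolding W C X_def A powr_powr powr_add[symmetric] powr_diff[symmetric]
    by (rule arg_cong[of _ _ "(powr) q"])
      (simp add: real_choose_two of_nat_diff le field_simps)
  have sgn: "(-1) ^ (N - n) * (-1) ^ (N - m) * (-1) ^ m = (-1 :: real) ^ n"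
  proof -
    \<comment> \<open>On each side the exponents add up to N.\<close>
    have "(-1 :: real) ^ (N - m) * (-1) ^ m = (-1) ^ (N - n) * (-1) ^ n"
      using le by (simp flip: power_add)
    then show ?thesis
      by (simp add: mult.assoc flip: power_mult_distrib)
  qed
  have "e_star_vec ket a q N \<alpha> \<beta> m \<bullet> f_vec ket a q N \<alpha> \<beta> \<mu> n =
      (\<Prod>i\<in>{n..<N}. a i) / (\<Prod>i\<in>{m..<N}. a i) *
      (X * ((w * q ^ (N - m)) ^ m * q ^ (m choose 2))) *
      ((-1) ^ (N - n) * (-1) ^ (N - m) * (-1) ^ m) *
      (qpoch q q N * qpoch y q m / (qpoch q q m * qpoch q q (N - n) * qpoch e q m)) *
      (qpoch e q (N - n) / qpoch v q (N - m)) * q_hahn m (q powr - real n) A B N q"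
    unfolding main by (simp add: mult_ac)
  then show ?thesis
    unfolding pw sgn y e v by (simp add: mult_ac)
qed

end

theorem proposition6p1:
  fixes q \<alpha> \<beta> \<mu> A B :: real and N :: nat and a :: "nat \<Rightarrow> real"
    and ket :: "nat \<Rightarrow> 'v::real_inner"
  assumes q: "q > 0" "q \<noteq> 1"
    and N: "N > 0"
    and a: "\<forall>i<N. a i \<noteq> 0"
    and ket: "orthonormal_basis N ket"
    and A: "A = q powr (\<mu> - \<beta> - 1)"
    and B: "B = q powr (- \<mu> - \<beta> - 1)"
    and den_e: "\<forall>n\<le>N. qpoch (q powr (real n - 2 * \<beta> - 1)) q n \<noteq> 0"
    and den_e_star: "\<forall>n\<le>N. qpoch (q powr (- real N - real n + 2 * \<beta> + 1)) q (N - n) \<noteq> 0"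
    and den_f: "\<forall>l\<le>N. qpoch (q powr (\<beta> - \<mu> - real N + 1)) q (N - l) \<noteq> 0"
    and den_f_star: "\<forall>l\<le>N. qpoch (q powr (\<mu> - \<beta>)) q l \<noteq> 0"
    and den_Q: "\<forall>k\<le>N. qpoch (A * q) q k \<noteq> 0"
    and den_S: "\<forall>m\<le>N. qpoch (A * B * q ^ (m + 1)) q m \<noteq> 0"
    and den_S_tilde: "\<forall>m\<le>N. qpoch (B * q) q m \<noteq> 0"
      "\<forall>m\<le>N. qpoch (A * B * q ^ (2 * m + 2)) q (N - m) \<noteq> 0"
  shows "\<forall>m\<le>N. \<forall>n\<le>N.
      e_vec ket a q N \<alpha> \<beta> m \<bullet> f_star_vec ket a q N \<alpha> \<beta> \<mu> n =
        (\<Prod>i<n. a i) / (\<Prod>i<m. a i)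
        * q powr (real m * (\<alpha> - \<beta> - real N + real m - 1)
                  + real n * (\<beta> - \<alpha> + real n / 2 + 1 / 2))
        * (qpoch q q N * (- 1) ^ n / (qpoch q q n * qpoch q q (N - m)))
        * (qpoch (A * q) q n / qpoch (A * B * q ^ (m + 1)) q m)
        * q_hahn m (q powr - real n) A B N q
    \<and>
      e_star_vec ket a q N \<alpha> \<beta> m \<bullet> f_vec ket a q N \<alpha> \<beta> \<mu> n =
        (\<Prod>i\<in>{n..<N}. a i) / (\<Prod>i\<in>{m..<N}. a i)
        * A powr (real N - real m - real n)
        * q powr (real m * (\<beta> - \<alpha> + real N - real m)
                  + real n * (\<alpha> - \<beta> - real n / 2 - 3 / 2) + real N)
        * (qpoch q q N * (- 1) ^ n * qpoch (A * q) q m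
           / (qpoch q q m * qpoch q q (N - n) * qpoch (B * q) q m))
        * (qpoch (B * q) q (N - n) / qpoch (A * B * q ^ (2 * m + 2)) q (N - m))
        * q_hahn m (q powr - real n) A B N q"
  using e_inner_f_star[OF q a ket A B] e_star_inner_f[OF q a ket A B den_f den_Q den_S_tilde(1)]
  by blast

end
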